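(* For natural numbers $n$ and $k$, apart from a trivial normalization factor, $\overline{\alpha}_{nk}$ is equal to $\alpha_{nk}$, where $$\overline{\alpha}_{nk}:=\begin{cases}1 & \text{if } k\mid n,\\ 0 & \text{if } k\nmid n,\end{cases}\qquad\text{and}\qquad \alpha_{nk}=\left.\frac{\mathrm{d}^{n}}{\mathrm{d}x^{n}}e^{x^{k}}\right|_{x=0}.$$
   Context: Here $n$ is a given natural number and $k$ is a natural number regarded as a possible divisor of $n$. The quantity $\overline{\alpha}_{nk}$ is called the characteristic function for divisors. The quantity $\alpha_{nk}$ is the $n$-th derivative with respect to $x$ of the function $x\mapsto e^{x^{k}}$, evaluated at $x=0$. The theorem does not specify the normalization factor. *)

theory Defs imports "HOL-Analysis.Analysis" begin

definition alpha_bar :: "nat \<Rightarrow> nat \<Rightarrow> real" where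
  "alpha_bar n k = (if k dvd n then 1 else 0)"

definition alpha :: "nat \<Rightarrow> nat \<Rightarrow> real" where
  "alpha n k = (deriv ^^ n) (\<lambda>x::real. exp (x ^ k)) 0"

end

theory Submission imports Defs begin

text \<open>
  The Taylor coefficients of \<open>exp (x ^ k)\<close> at \<open>0\<close> for \<open>k > 0\<close> can be read off from
  the exponential series: the coefficient of \<open>x ^ n\<close> is \<open>1 / (n / k)!\<close> if
  \<open>k\<close> divides \<open>n\<close>, and zero otherwise. For \<open>k = 0\<close> the function is the constant \<open>e\<close>, whose only
  nonvanishing derivative is the zeroth, in accordance with \<open>0\<close> dividing only \<open>0\<close>.
\<close>

lemma has_fps_expansion_higher_deriv:
  fixes f :: "'a :: {banach, real_normed_field} \<Rightarrow> 'a"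
  assumes "f has_fps_expansion F"
  shows "(deriv ^^ n) f has_fps_expansion (fps_deriv ^^ n) F"
  by (induction n) (auto intro: has_fps_expansion_deriv assms)

lemma fps_nth_0_higher_deriv:
  fixes F :: "'a :: {comm_ring_1, semiring_char_0} fps"
  shows "fps_nth ((fps_deriv ^^ n) F) 0 = fact n * fps_nth F n"
  \<comment> \<open>The innermost derivative is split off, so the induction hypothesis applies to
    \<open>fps_deriv F\<close>.\<close>
  by (induction n arbitrary: F) (simp_all add: funpow_Suc_right algebra_simps del: funpow.simps)

lemma higher_deriv_0_eq_fps_nth:
  fixes f :: "'a :: {banach, real_normed_field} \<Rightarrow> 'a"
  assumes "f has_fps_expansion F"
  shows "(deriv ^^ n) f 0 = fact n * fps_nth F n"
proof -
  have "\<forall>\<^sub>F z in nhds 0. eval_fps ((fps_deriv ^^ n) F) z = (deriv ^^ n) f z"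
    using has_fps_expansion_higher_deriv[OF assms] by (simp add: has_fps_expansion_def)
  then have "eval_fps ((fps_deriv ^^ n) F) 0 = (deriv ^^ n) f 0"
    \<comment> \<open>Unlike \<open>at 0\<close>, the filter \<open>nhds 0\<close> includes the
      point \<open>0\<close> itself.\<close>
    by (rule eventually_nhds_x_imp_x)
  then show ?thesis
    by (simp add: eval_fps_at_0 fps_nth_0_higher_deriv)
qed

lemma has_fps_expansion_exp_power:
  assumes "k > 0"
  shows "(\<lambda>x :: 'a :: {banach, real_normed_field}. exp (x ^ k)) has_fps_expansion
           Abs_fps (\<lambda>n. if k dvd n then 1 / fact (n div k) else 0)"
    (is "_ has_fps_expansion ?F")
proof (rule has_fps_expansionI, rule always_eventually, rule allI)
  fix x :: 'a
  have "(\<lambda>m. fps_nth ?F (k * m) * x ^ (k * m)) sums exp (x ^ k)"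
    using exp_converges[of "x ^ k"] assms
    by (simp add: scaleR_conv_of_real field_simps flip: power_mult)
  moreover have "strict_mono ((*) k)"
    using assms by (simp add: strict_mono_def)
  \<comment> \<open>The terms at non-multiples of \<open>k\<close> can be inserted since they are
    zero.\<close>
  ultimately show "(\<lambda>n. fps_nth ?F n * x ^ n) sums exp (x ^ k)"
    by (subst (asm) sums_mono_reindex[of "(*) k"]) auto
qed

lemma higher_deriv_exp_power_0:
  assumes "k > 0"
  shows "(deriv ^^ n) (\<lambda>x :: 'a :: {banach, real_normed_field}. exp (x ^ k)) 0 =
           (if k dvd n then fact n / fact (n div k) else 0)"
  by (simp add: higher_deriv_0_eq_fps_nth[OF has_fps_expansion_exp_power[OF assms]])

lemma higher_deriv_const:
  "(deriv ^^ n) (\<lambda>_. c) = (\<lambda>_. if n = 0 then c else 0)"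
  by (induction n) auto

theorem mainTheorem1:
  fixes n k :: nat
  shows "\<exists>c::real. c \<noteq> 0 \<and> alpha_bar n k = c * alpha n k"
proof -
  have "alpha n k \<noteq> 0 \<longleftrightarrow> k dvd n"
    by (cases "k = 0") (simp_all add: alpha_def higher_deriv_const higher_deriv_exp_power_0)
  then show ?thesis
    \<comment> \<open>If \<open>k\<close> does not divide \<open>n\<close>, both sides vanish and
      any nonzero factor serves.\<close>
    by (intro exI[of _ "if k dvd n then inverse (alpha n k) else 1"]) (auto simp: alpha_bar_def)
qed

end
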